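(* Let $n\ge2$. For every $i\in[n]$, $\eta\circ\tau_i=t_i\circ\eta$ as maps $\mathcal I_n\to J(\mathcal Z_n)$. Thus $\eta\circ\varphi=\mathrm{Pro}\circ\eta$, where $\varphi=\tau_n\cdots\tau_2\tau_1$ and $\mathrm{Pro}=t_n\cdots t_2t_1$, making $\eta$ an equivariant bijection.
   Context: $[n]=\{1,\dots,n\}$. $\mathcal I_n$ is the set of independent sets of the path graph on $[n]$, i.e. subsets $S\subseteq[n]$ containing no two consecutive integers. For $i\in[n]$ the toggle $\tau_i:\mathcal I_n\to\mathcal I_n$ is defined by: $\tau_i(S)=S\setminus\{i\}$ if $i\in S$; $\tau_i(S)=S\cup\{i\}$ if $i\notin S$ and $S\cup\{i\}\in\mathcal I_n$; and $\tau_i(S)=S$ otherwise. The zigzag poset $\mathcal Z_n$ has elements $a_1,\dots,a_n$ and relations $a_{2i-1}<a_{2i}$ and $a_{2i+1}<a_{2i}$ (whenever the indices lie in $[n]$). $J(\mathcal Z_n)$ is the set of order ideals (down-closed subsets) of $\mathcal Z_n$. The toggle $t_i:J(\mathcal Z_n)\to J(\mathcal Z_n)$ is: $t_i(I)=I\cup\{a_i\}$ if $a_i\notin I$ and $I\cup\{a_i\}\in J(\mathcal Z_n)$; $t_i(I)=I\setminus\{a_i\}$ if $a_i\in I$ and $I\setminus\{a_i\}\in J(\mathcal Z_n)$; and $t_i(I)=I$ otherwise. Products of toggles are compositions performed from right to left. The map $\eta:\mathcal I_n\to J(\mathcal Z_n)$ is $\eta(S)=\{a_i : i\in[n],\ i\text{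 odd},\ i\notin S\}\cup\{a_i : i\in[n],\ i\text{ even},\ i\in S\}$. *)

theory Defs
  imports Main
begin

definition indep_sets :: "nat \<Rightarrow> nat set set" where
  "indep_sets n = {S. S \<subseteq> {1..n} \<and> (\<forall>i. \<not> (i \<in> S \<and> i + 1 \<in> S))}"

definition indep_toggle :: "nat \<Rightarrow> nat \<Rightarrow> nat set \<Rightarrow> nat set" where
  "indep_toggle n i S =
     (if i \<in> S then S - {i}
      else if S \<union> {i} \<in> indep_sets n then S \<union> {i}
      else S)"

text \<open>The poset element \<open>a\<^sub>i\<close> is \<open>Elt i\<close>; the carrier of the zigzag poset of size \<open>n\<close>
  consists of the \<open>Elt i\<close> with \<open>1 \<le> i \<le> n\<close>.\<close>

datatype zigzag_elt = Elt nat

definition zigzag_carrier :: "nat \<Rightarrow> zigzag_elt set" where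
  "zigzag_carrier n = Elt ` {1..n}"

definition zigzag_less :: "nat \<Rightarrow> (zigzag_elt \<times> zigzag_elt) set" where
  "zigzag_less n =
     {(Elt (2 * k - 1), Elt (2 * k)) | k. 2 * k - 1 \<in> {1..n} \<and> 2 * k \<in> {1..n}} \<union>
     {(Elt (2 * k + 1), Elt (2 * k)) | k. 2 * k + 1 \<in> {1..n} \<and> 2 * k \<in> {1..n}}"

text \<open>The generating relations are already transitive (vacuously: minimal elements have odd and
  maximal elements have even index), so only reflexive pairs have to be added.\<close>

definition zigzag_le :: "nat \<Rightarrow> (zigzag_elt \<times> zigzag_elt) set" where
  "zigzag_le n = Id_on (zigzag_carrier n) \<union> zigzag_less n"

lemma zigzag_less_parity:
  assumes "(Elt i, Elt j) \<in> zigzag_less n"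
  shows "odd i" "even j" "i \<in> {1..n}" "j \<in> {1..n}"
  using assms by (auto simp: zigzag_less_def)

lemma partial_order_zigzag_le: "partial_order_on (zigzag_carrier n) (zigzag_le n)"
proof -
  have parity: "odd i \<and> even j \<and> i \<in> {1..n} \<and> j \<in> {1..n}"
    if "(Elt i, Elt j) \<in> zigzag_less n" for i j
    using zigzag_less_parity[OF that] by simp
  have sub: "zigzag_le n \<subseteq> zigzag_carrier n \<times> zigzag_carrier n"
  proof
    fix p assume p: "p \<in> zigzag_le n"
    obtain i j where ij: "p = (Elt i, Elt j)" by (metis surj_pair zigzag_elt.exhaust)
    show "p \<in> zigzag_carrier n \<times> zigzag_carrier n"
      using p parity[of i j] unfolding ij zigzag_le_def zigzag_carrier_def by auto
  qed
  have "refl_on (zigzag_carrier n) (zigzag_le n)"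
    using sub by (auto simp: refl_on_def zigzag_le_def)
  moreover have "trans (zigzag_le n)"
  proof (rule transI)
    fix x y z assume *: "(x, y) \<in> zigzag_le n" "(y, z) \<in> zigzag_le n"
    obtain i j k where "x = Elt i" "y = Elt j" "z = Elt k" by (metis zigzag_elt.exhaust)
    with * show "(x, z) \<in> zigzag_le n"
      using parity[of i j] parity[of j k] unfolding zigzag_le_def by auto
  qed
  moreover have "antisym (zigzag_le n)"
  proof (rule antisymI)
    fix x y assume *: "(x, y) \<in> zigzag_le n" "(y, x) \<in> zigzag_le n"
    obtain i j where "x = Elt i" "y = Elt j" by (metis zigzag_elt.exhaust)
    with * show "x = y"
      using parity[of i j] parity[of j i] unfolding zigzag_le_def by auto
  qed
  ultimately show ?thesis
    using sub by (simp add: partial_order_on_def preorder_on_def)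
qed

definition zigzag_ideals :: "nat \<Rightarrow> zigzag_elt set set" where
  "zigzag_ideals n =
     {I. I \<subseteq> zigzag_carrier n \<and> (\<forall>x y. y \<in> I \<and> (x, y) \<in> zigzag_le n \<longrightarrow> x \<in> I)}"

definition ideal_toggle :: "nat \<Rightarrow> nat \<Rightarrow> zigzag_elt set \<Rightarrow> zigzag_elt set" where
  "ideal_toggle n i I =
     (if Elt i \<notin> I \<and> I \<union> {Elt i} \<in> zigzag_ideals n then I \<union> {Elt i}
      else if Elt i \<in> I \<and> I - {Elt i} \<in> zigzag_ideals n then I - {Elt i}
      else I)"

lemma indep_toggle_closed:
  "S \<in> indep_sets n \<Longrightarrow> indep_toggle n i S \<in> indep_sets n"
  by (auto simp: indep_toggle_def indep_sets_def)

lemma ideal_toggle_closed: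
  "I \<in> zigzag_ideals n \<Longrightarrow> ideal_toggle n i I \<in> zigzag_ideals n"
  by (auto simp: ideal_toggle_def)

text \<open>\<open>toggle_product f m\<close> is the composition \<open>f m \<circ> \<dots> \<circ> f 2 \<circ> f 1\<close>, so \<open>f 1\<close> acts first.\<close>

primrec toggle_product :: "(nat \<Rightarrow> 'a \<Rightarrow> 'a) \<Rightarrow> nat \<Rightarrow> 'a \<Rightarrow> 'a" where
  "toggle_product f 0 = id"
| "toggle_product f (Suc m) = f (Suc m) \<circ> toggle_product f m"

definition phi :: "nat \<Rightarrow> nat set \<Rightarrow> nat set" where
  "phi n = toggle_product (indep_toggle n) n"

definition Pro :: "nat \<Rightarrow> zigzag_elt set \<Rightarrow> zigzag_elt set" where
  "Pro n = toggle_product (ideal_toggle n) n"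

definition eta :: "nat \<Rightarrow> nat set \<Rightarrow> zigzag_elt set" where
  "eta n S = {Elt i | i. i \<in> {1..n} \<and> odd i \<and> i \<notin> S} \<union>
             {Elt i | i. i \<in> {1..n} \<and> even i \<and> i \<in> S}"

end

theory Submission
  imports Defs
begin

text \<open>Both toggles at \<open>i\<close> replace a set by its symmetric difference with the singleton of \<open>i\<close>
  whenever the result is still admissible, and do nothing otherwise. The map \<open>\<eta>\<close> is the symmetric
  difference with the set of odd-indexed elements, so it commutes with flipping one element and is
  a bijection on all subsets. It matches admissibility because the constraint
  \<open>a\<^sub>j \<in> I \<longrightarrow> a\<^sub>i \<in> I\<close> for adjacent odd \<open>i\<close> and even \<open>j\<close> says exactly that \<open>i\<close> and
  \<open>j\<close> are not both in \<open>S\<close>.\<close>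

lemma Elt_mem_zigzag_carrier_iff [simp]: "Elt i \<in> zigzag_carrier n \<longleftrightarrow> i \<in> {1..n}"
  by (auto simp: zigzag_carrier_def)

text \<open>The range conditions exclude \<open>k = 0\<close>, so the truncated subtraction in
  \<open>2 * k - 1\<close> is harmless and the two families merge into adjacency with the odd index
  below.\<close>

lemma zigzag_less_iff:
  "(Elt i, Elt j) \<in> zigzag_less n \<longleftrightarrow>
     i \<in> {1..n} \<and> j \<in> {1..n} \<and> odd i \<and> even j \<and> (j = i + 1 \<or> i = j + 1)"
proof
  assume "(Elt i, Elt j) \<in> zigzag_less n"
  then show "i \<in> {1..n} \<and> j \<in> {1..n} \<and> odd i \<and> even j \<and> (j = i + 1 \<or> i = j + 1)"
    by (auto simp: zigzag_less_def)
next
  assume *: "i \<in> {1..n} \<and> j \<in> {1..n} \<and> odd i \<and> even j \<and> (j = i + 1 \<or> i = j + 1)"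
  then obtain k where k: "j = 2 * k" by (auto elim: evenE)
  from * show "(Elt i, Elt j) \<in> zigzag_less n"
  proof (elim conjE disjE)
    assume "i \<in> {1..n}" "j \<in> {1..n}" "j = i + 1"
    then have "i = 2 * k - 1" "2 * k - 1 \<in> {1..n}" "2 * k \<in> {1..n}" using k by auto
    with k show ?thesis unfolding zigzag_less_def by blast
  next
    assume "i \<in> {1..n}" "j \<in> {1..n}" "i = j + 1"
    with k show ?thesis unfolding zigzag_less_def by blast
  qed
qed

text \<open>Reflexive pairs impose no closure condition, so only the generating relations have to be
  tested.\<close>

lemma zigzag_ideals_iff:
  "I \<in> zigzag_ideals n \<longleftrightarrow>
     I \<subseteq> zigzag_carrier n \<and> (\<forall>i j. Elt j \<in> I \<and> (Elt i, Elt j) \<in> zigzag_less n \<longrightarrow> Elt i \<in> I)"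
proof -
  have all_Elt: "(\<forall>x. P x) \<longleftrightarrow> (\<forall>i. P (Elt i))" for P
    by (metis zigzag_elt.exhaust)
  show ?thesis
    unfolding zigzag_ideals_def zigzag_le_def mem_Collect_eq all_Elt by blast
qed

lemma Elt_mem_eta_iff [simp]: "Elt i \<in> eta n S \<longleftrightarrow> i \<in> {1..n} \<and> (odd i \<longleftrightarrow> i \<notin> S)"
  by (auto simp: eta_def)

lemma eta_subset_zigzag_carrier: "eta n S \<subseteq> zigzag_carrier n"
  by (auto simp: eta_def)

text \<open>Arbitrary subsets are allowed so that the equivalence also covers candidates that a
  toggle rejects.\<close>

lemma eta_mem_zigzag_ideals_iff:
  assumes "S \<subseteq> {1..n}"
  shows "eta n S \<in> zigzag_ideals n \<longleftrightarrow> S \<in> indep_sets n"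
proof
  assume ideal: "eta n S \<in> zigzag_ideals n"
  have "\<not> (i \<in> S \<and> i + 1 \<in> S)" for i
  proof
    assume i: "i \<in> S \<and> i + 1 \<in> S"
    with assms have range: "i \<in> {1..n}" "i + 1 \<in> {1..n}" by auto
    show False
    \<comment> \<open>Of \<open>i\<close> and \<open>i + 1\<close>, the even one puts its element
      into the ideal; the odd one lies below it, yet its element is missing because its index is in
      \<open>S\<close>.\<close>
    proof (cases "even i")
      case True
      with range have "(Elt (i + 1), Elt i) \<in> zigzag_less n"
        unfolding zigzag_less_iff by simp
      moreover have "Elt i \<in> eta n S" using i range True by simp
      ultimately have "Elt (i + 1) \<in> eta n S"
        using ideal unfolding zigzag_ideals_iff by blast
      with i True show False by simp
    next
      case False
      with range have "(Elt i, Elt (i + 1)) \<in> zigzag_less n"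
        unfolding zigzag_less_iff by simp
      moreover have "Elt (i + 1) \<in> eta n S" using i range False by simp
      ultimately have "Elt i \<in> eta n S"
        using ideal unfolding zigzag_ideals_iff by blast
      with i False show False by simp
    qed
  qed
  with assms show "S \<in> indep_sets n" by (simp add: indep_sets_def)
next
  assume "S \<in> indep_sets n"
  then show "eta n S \<in> zigzag_ideals n"
    using eta_subset_zigzag_carrier
    by (auto simp: zigzag_ideals_iff zigzag_less_iff indep_sets_def)
qed

lemma bij_betw_eta_Pow: "bij_betw (eta n) (Pow {1..n}) (Pow (zigzag_carrier n))"
\<comment> \<open>The inverse solves \<open>odd i \<longleftrightarrow> i \<notin> S\<close> for
  membership of \<open>i\<close> in \<open>S\<close>.\<close>
proof (rule bij_betw_byWitness[where f' = "\<lambda>I. {i \<in> {1..n}. odd i \<longleftrightarrow> Elt i \<notin> I}"])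
  show "\<forall>I\<in>Pow (zigzag_carrier n). eta n {i \<in> {1..n}. odd i \<longleftrightarrow> Elt i \<notin> I} = I"
  proof
    fix I assume "I \<in> Pow (zigzag_carrier n)"
    then have "Elt i \<in> eta n {i \<in> {1..n}. odd i \<longleftrightarrow> Elt i \<notin> I} \<longleftrightarrow> Elt i \<in> I" for i
      using Elt_mem_zigzag_carrier_iff[of i n] by auto
    then have "x \<in> eta n {i \<in> {1..n}. odd i \<longleftrightarrow> Elt i \<notin> I} \<longleftrightarrow> x \<in> I" for x
      by (cases x) simp
    then show "eta n {i \<in> {1..n}. odd i \<longleftrightarrow> Elt i \<notin> I} = I"
      by (rule set_eqI)
  qed
  show "\<forall>S\<in>Pow {1..n}. {i \<in> {1..n}. odd i \<longleftrightarrow> Elt i \<notin> eta n S} = S"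
    by auto
  show "eta n ` Pow {1..n} \<subseteq> Pow (zigzag_carrier n)"
    by (simp add: image_subset_iff eta_subset_zigzag_carrier)
  show "(\<lambda>I. {i \<in> {1..n}. odd i \<longleftrightarrow> Elt i \<notin> I}) ` Pow (zigzag_carrier n) \<subseteq> Pow {1..n}"
    by (intro image_subsetI PowI Collect_restrict)
qed

text \<open>An ideal has a preimage among all subsets, and the admissibility equivalence makes that
  preimage independent.\<close>

lemma bij_betw_eta: "bij_betw (eta n) (indep_sets n) (zigzag_ideals n)"
proof (rule bij_betw_subset[OF bij_betw_eta_Pow])
  show indep: "indep_sets n \<subseteq> Pow {1..n}" by (auto simp: indep_sets_def)
  show "eta n ` indep_sets n = zigzag_ideals n"
  proof
    show "eta n ` indep_sets n \<subseteq> zigzag_ideals n"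
      using indep eta_mem_zigzag_ideals_iff by blast
    show "zigzag_ideals n \<subseteq> eta n ` indep_sets n"
    proof
      fix I assume I: "I \<in> zigzag_ideals n"
      then have "I \<in> eta n ` Pow {1..n}"
        unfolding bij_betw_imp_surj_on[OF bij_betw_eta_Pow] zigzag_ideals_iff by simp
      with I show "I \<in> eta n ` indep_sets n"
        using eta_mem_zigzag_ideals_iff by auto
    qed
  qed
qed

lemma eta_insert:
  assumes "i \<in> {1..n}" "i \<notin> S"
  shows "eta n (S \<union> {i}) = (if odd i then eta n S - {Elt i} else eta n S \<union> {Elt i})"
  using assms by (auto simp: eta_def)

lemma eta_remove:
  assumes "i \<in> {1..n}" "i \<in> S"
  shows "eta n (S - {i}) = (if odd i then eta n S \<union> {Elt i} else eta n S - {Elt i})"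
  using assms by (auto simp: eta_def)

lemma eta_indep_toggle:
  assumes i: "i \<in> {1..n}" and S: "S \<in> indep_sets n"
  shows "eta n (indep_toggle n i S) = ideal_toggle n i (eta n S)"
proof (cases "i \<in> S")
  case True
  \<comment> \<open>\<open>indep_toggle\<close> removes without a test while
    \<open>ideal_toggle\<close> tests; removal keeps independence, so that test succeeds.\<close>
  have "S - {i} \<in> indep_sets n" using S by (auto simp: indep_sets_def)
  moreover have "S - {i} \<subseteq> {1..n}" using S by (auto simp: indep_sets_def)
  ultimately have "eta n (S - {i}) \<in> zigzag_ideals n"
    by (simp only: eta_mem_zigzag_ideals_iff)
  then show ?thesis
    using True i unfolding eta_remove[OF i True] indep_toggle_def ideal_toggle_def
    by (cases "odd i") (simp_all only: Elt_mem_eta_iff eta_remove if_True if_False simp_thms)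
next
  case False
  have "S \<union> {i} \<subseteq> {1..n}" using S i by (auto simp: indep_sets_def)
  \<comment> \<open>After unfolding, this equates the tests of the two toggles, so both flip or both
    do nothing.\<close>
  note ideal_iff = eta_mem_zigzag_ideals_iff[OF this, unfolded eta_insert[OF i False]]
  show ?thesis
  proof (cases "odd i")
    case True
    then show ?thesis using ideal_iff False i
      by (simp only: indep_toggle_def ideal_toggle_def Elt_mem_eta_iff if_distrib[of "eta n"]
          eta_insert if_True if_False simp_thms)
  next
    case even: False
    then show ?thesis using ideal_iff False i
      by (simp only: indep_toggle_def ideal_toggle_def Elt_mem_eta_iff if_distrib[of "eta n"]
          eta_insert if_True if_False simp_thms)
  qed
qed

text \<open>Keeps every intermediate set within the scope of
  \<open>eta_indep_toggle\<close>.\<close>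

lemma toggle_product_indep_closed:
  "S \<in> indep_sets n \<Longrightarrow> toggle_product (indep_toggle n) m S \<in> indep_sets n"
  by (induction m) (simp_all add: indep_toggle_closed)

text \<open>Each factor is moved past \<open>eta\<close> in turn; \<open>m \<le> n\<close> keeps its
  index in range, and \<open>m = n\<close> gives \<open>phi\<close> and \<open>Pro\<close>.\<close>

lemma eta_toggle_product:
  assumes "S \<in> indep_sets n" "m \<le> n"
  shows "eta n (toggle_product (indep_toggle n) m S) = toggle_product (ideal_toggle n) m (eta n S)"
  using assms(2)
  by (induction m) (simp_all add: eta_indep_toggle toggle_product_indep_closed assms(1))

theorem proposition5p6:
  fixes n :: nat
  assumes "n \<ge> 2"
  shows "(\<forall>i\<in>{1..n}. \<forall>S\<in>indep_sets n.
            (eta n \<circ> indep_toggle n i) S = (ideal_toggle n i \<circ> eta n) S)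
       \<and> (\<forall>S\<in>indep_sets n. (eta n \<circ> phi n) S = (Pro n \<circ> eta n) S)
       \<and> bij_betw (eta n) (indep_sets n) (zigzag_ideals n)"
  using eta_indep_toggle eta_toggle_product bij_betw_eta by (simp add: phi_def Pro_def)

end
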